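(* Let $n,k,r$ be positive integers with $n>36k(2k+1)(k+r)r^2$. Let $\mathcal{F}\subset \binom{[n]}{k}$ be any family of size $m$. (i) If $m\in\left\{\binom{n}{k}-\binom{n-r_1}{k}:1\leq r_1\leq r\right\}$, then $\omega(\mathcal{F})\leq \omega(\mathcal{L}_{n,k}^{m})$, with equality if and only if $\mathcal{F}= \mathcal{L}_{n,k}^{m}$ up to isomorphism. (ii) If $m\in\left\{\binom{n-r_1}{k}:1\leq r_1\leq r\right\}$, then $\omega(\mathcal{F})\leq \omega\left(\binom{[n]}{k}\setminus\mathcal{L}_{n,k}^{\binom{n}{k}-m}\right)$, with equality if and only if $\mathcal{F}= \binom{[n]}{k}\setminus\mathcal{L}_{n,k}^{\binom{n}{k}-m}$ up to isomorphism.
   Context: $[n]=\{1,\ldots,n\}$, and $\binom{[n]}{k}$ is the family of all $k$-element subsets of $[n]$. For a family of sets $\mathcal{F}$, $\omega(\mathcal{F}):=\sum_{\{A,B\}\subset \mathcal{F}}|A\cap B|$, the sum being over unordered pairs of distinct members of $\mathcal{F}$. Two families in $\binom{[n]}{k}$ are equal up to isomorphism if some permutation of $[n]$ maps one onto the other. Lexicographical ordering: $A$ is smaller than $B$ if and only if the minimum element of $A\setminus B$ is smaller than that of $B\setminus A$. For $0\leq j\leq\binom{n}{k}$, $\mathcal{L}_{n,k}^j$ is the family of the first $j$ sets of $\binom{[n]}{k}$ in the lexicographical ordering. Here $r_1$ ranges over integers. *)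

theory Defs
  imports
    "HOL-Library.Ramsey"
    "HOL-Combinatorics.Permutations"
begin

text \<open>
  The family of all \<open>k\<close>-element subsets of \<open>{1..n}\<close> is \<open>nsets {1..n} k\<close>, with \<open>nsets\<close> from
  \<^theory>\<open>HOL-Library.Ramsey\<close>. Unordered pairs of distinct members of a family \<open>F\<close> are likewise
  the elements \<open>P\<close> of \<open>nsets F 2\<close>; for \<open>P = {A, B}\<close> the summand below is \<open>card (A \<inter> B)\<close>.
\<close>

definition omega :: "nat set set \<Rightarrow> nat" where
  "omega F = (\<Sum>P\<in>nsets F 2. card (\<Inter>P))"

text \<open>
  The order is only used between finite sets of the same cardinality. If these are distinct, both
  differences are nonempty, so \<open>Min\<close> is meaningful; if they are equal, the two sides coincide and
  the relation is false.
\<close>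

definition lex_less :: "nat set \<Rightarrow> nat set \<Rightarrow> bool" where
  "lex_less A B \<longleftrightarrow> Min (A - B) < Min (B - A)"

text \<open>
  A \<open>k\<close>-set is among the first \<open>j\<close> ones iff fewer than \<open>j\<close> many \<open>k\<close>-sets strictly precede it.
\<close>

definition lex_initial :: "nat \<Rightarrow> nat \<Rightarrow> nat \<Rightarrow> nat set set" where
  "lex_initial n k j =
     {A \<in> nsets {1..n} k. card {B \<in> nsets {1..n} k. lex_less B A} < j}"

definition family_iso :: "nat \<Rightarrow> nat set set \<Rightarrow> nat set set \<Rightarrow> bool" where
  "family_iso n F G \<longleftrightarrow> (\<exists>p. p permutes {1..n} \<and> (\<lambda>A. p ` A) ` F = G)"

end

theory Submission
  imports Defs "HOL-Analysis.Convex"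
begin

text \<open>
  Write \<open>d\<^sub>F(i)\<close> for the number of members of \<open>F\<close> that contain \<open>i\<close>. Counting the triples
  \<open>(A, B, i)\<close> with \<open>i \<in> A \<inter> B\<close> gives \<open>\<Sum>\<^sub>i d\<^sub>F(i)\<^sup>2 = 2 \<omega>(F) + k |F|\<close>
  (lemma \<open>square_sum_eq_omega\<close>), so for a fixed size of \<open>F\<close> the task is to maximise the sum of
  squared degrees. The lexicographic initial segment of size \<open>C(n, k) - C(n - r, k)\<close> consists of
  the \<open>k\<close>-sets that meet \<open>{1..r}\<close> (lemma \<open>lex_initial_eq_meeting\<close>).

  Let \<open>F\<close> have this size, let \<open>R\<close> be a set of \<open>r\<close> points of largest degree in \<open>F\<close>, and compare
  \<open>F\<close> with the equally large family \<open>G\<close> of all \<open>k\<close>-sets that meet \<open>R\<close>. Put \<open>H = F - G\<close> and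
  \<open>K = G - F\<close>, both of size \<open>a\<close>. Then
  \<open>\<Sum>\<^sub>i d\<^sub>G(i)\<^sup>2 - \<Sum>\<^sub>i d\<^sub>F(i)\<^sup>2\<close> is the sum over \<open>A \<in> K\<close> minus the sum over \<open>A \<in> H\<close> of
  \<open>\<Sum>\<^bsub>i\<in>A\<^esub> (d\<^sub>G(i) + d\<^sub>F(i))\<close>. Let \<open>D\<close> be the degree of a point in the family of all \<open>k\<close>-sets,
  \<open>E\<close> the degree of a pair there, and \<open>x\<close> the least degree of \<open>F\<close> on \<open>R\<close>. Every \<open>A \<in> K\<close> contains
  a point of \<open>R\<close> and contributes at least \<open>D + x\<close>. The members of \<open>H\<close> avoid \<open>R\<close>; outside \<open>R\<close> both
  \<open>d\<^sub>G\<close> and the part of \<open>d\<^sub>F\<close> that comes from \<open>F \<inter> G\<close> are at most \<open>r E\<close>, so together the members of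
  \<open>H\<close> contribute at most \<open>2 k a r E + s\<close> with \<open>s = \<Sum>\<^sub>i d\<^sub>H(i)\<^sup>2\<close>.

  A single member of \<open>H\<close> could have weight \<open>k x\<close>, which is too much. On average this cannot
  happen, because two points lie in at most \<open>E\<close> common members: the Cauchy-Schwarz inequality
  gives \<open>s\<^sup>2 \<le> a (x s + E (k a)\<^sup>2)\<close> (lemma \<open>square_sum_power2_le\<close>). As \<open>a \<le> |G| \<le> r D\<close> and \<open>E\<close> is about
  \<open>k D / n\<close>, this forces \<open>s < a (x + D / 2)\<close> for large \<open>n\<close>. The \<open>x\<close> cancels in the comparison, and
  \<open>G\<close> wins strictly unless \<open>a = 0\<close>, that is, unless \<open>F = G\<close> (lemma \<open>square_sum_less_meeting\<close>).

  The second part is the first one for the complementary family: all points have the same degree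
  in the family of all \<open>k\<close>-sets, so passing to complements changes \<open>\<omega>\<close> by an amount
  that depends only on the size of the family (lemma \<open>omega_complement_diff\<close>).
\<close>

section \<open>Degrees and double counting\<close>

definition degree :: "'a set set \<Rightarrow> 'a \<Rightarrow> nat" where
  "degree F i = card {A \<in> F. i \<in> A}"

definition square_sum :: "'a set \<Rightarrow> 'a set set \<Rightarrow> real" where
  "square_sum V F = (\<Sum>i\<in>V. (real (degree F i))\<^sup>2)"

definition meeting :: "'a set \<Rightarrow> nat \<Rightarrow> 'a set \<Rightarrow> 'a set set" where
  "meeting V k R = {A \<in> nsets V k. A \<inter> R \<noteq> {}}"

lemma finite_nsets: "finite V \<Longrightarrow> finite (nsets V k)"
  by (simp add: finite_imp_finite_nsets)

lemma finite_family: "finite V \<Longrightarrow> F \<subseteq> nsets V k \<Longrightarrow> finite F"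
  using finite_nsets finite_subset by blast

lemma sum_members_eq_sum_degree:
  fixes f :: "'a \<Rightarrow> real"
  assumes "finite V" "finite F" "\<And>A. A \<in> F \<Longrightarrow> A \<subseteq> V"
  shows "(\<Sum>A\<in>F. \<Sum>i\<in>A. f i) = (\<Sum>i\<in>V. degree F i * f i)"
proof -
  have "(\<Sum>A\<in>F. \<Sum>i\<in>A. f i) = (\<Sum>A\<in>F. \<Sum>i | i \<in> V \<and> i \<in> A. f i)"
    using assms(3) by (intro sum.cong refl) (auto intro!: arg_cong2[where f=sum])
  also have "\<dots> = (\<Sum>i\<in>V. \<Sum>A | A \<in> F \<and> i \<in> A. f i)"
    using assms by (intro sum.swap_restrict)
  finally show ?thesis by (simp add: degree_def)
qed

lemma sum_degree:
  assumes "finite V" "F \<subseteq> nsets V k"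
  shows "(\<Sum>i\<in>V. real (degree F i)) = real k * real (card F)"
proof -
  have "(\<Sum>A\<in>F. \<Sum>i\<in>A. 1::real) = (\<Sum>i\<in>V. real (degree F i) * 1)"
    using assms(2) by (intro sum_members_eq_sum_degree assms(1) finite_family[OF assms])
      (auto simp: nsets_def)
  moreover have "(\<Sum>A\<in>F. \<Sum>i\<in>A. 1::real) = (\<Sum>A\<in>F. real k)"
    using assms(2) by (intro sum.cong) (auto simp: nsets_def)
  ultimately show ?thesis by simp
qed

lemma degree_mono: "finite G \<Longrightarrow> F \<subseteq> G \<Longrightarrow> degree F i \<le> degree G i"
  unfolding degree_def by (intro card_mono) auto

lemma degree_Un:
  assumes "finite F" "finite G" "F \<inter> G = {}"
  shows "degree (F \<union> G) i = degree F i + degree G i"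
proof -
  have "{A \<in> F \<union> G. i \<in> A} = {A \<in> F. i \<in> A} \<union> {A \<in> G. i \<in> A}" by blast
  moreover have "{A \<in> F. i \<in> A} \<inter> {A \<in> G. i \<in> A} = {}" using assms(3) by blast
  ultimately show ?thesis
    unfolding degree_def using assms(1,2) by (simp add: card_Un_disjoint)
qed

lemma degree_pos_D: "degree F i \<noteq> 0 \<Longrightarrow> \<exists>A\<in>F. i \<in> A"
  unfolding degree_def by (metis (mono_tags, lifting) Collect_empty_eq card.empty)

text \<open>
  An induction step that turns the sum over two-element subfamilies into a sum over ordered pairs.
\<close>

lemma omega_insert:
  assumes "finite F" "A \<notin> F"
  shows "omega (insert A F) = omega F + (\<Sum>B\<in>F. card (A \<inter> B))"
proof -
  have eq: "nsets (insert A F) 2 = nsets F 2 \<union> (\<lambda>B. {A, B}) ` F"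
  proof (intro equalityI subsetI)
    fix P assume "P \<in> nsets (insert A F) 2"
    then obtain X Y where "P = {X, Y}" "X \<noteq> Y" "X \<in> insert A F" "Y \<in> insert A F"
      by (auto simp: nsets_2_eq)
    then show "P \<in> nsets F 2 \<union> (\<lambda>B. {A, B}) ` F"
      by (auto simp: insert_commute)
  next
    fix P assume "P \<in> nsets F 2 \<union> (\<lambda>B. {A, B}) ` F"
    then show "P \<in> nsets (insert A F) 2"
      using assms(2) by (auto simp: nsets_2_eq)
  qed
  have disj: "nsets F 2 \<inter> (\<lambda>B. {A, B}) ` F = {}"
    using assms(2) by (auto simp: nsets_def)
  have inj: "inj_on (\<lambda>B. {A, B}) F"
    using assms(2) by (auto simp: inj_on_def doubleton_eq_iff)
  have "omega (insert A F) = omega F + (\<Sum>P\<in>(\<lambda>B. {A, B}) ` F. card (\<Inter>P))"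
    unfolding omega_def eq using assms disj
    by (intro sum.union_disjoint) (auto simp: finite_imp_finite_nsets)
  also have "(\<Sum>P\<in>(\<lambda>B. {A, B}) ` F. card (\<Inter>P)) = (\<Sum>B\<in>F. card (A \<inter> B))"
    by (subst sum.reindex[OF inj]) simp
  finally show ?thesis .
qed

lemma omega_ordered_pairs:
  assumes "finite F"
  shows "2 * omega F + (\<Sum>A\<in>F. card A) = (\<Sum>A\<in>F. \<Sum>B\<in>F. card (A \<inter> B))"
  using assms
proof (induction F rule: finite_induct)
  case empty
  have "nsets {} 2 = ({} :: nat set set set)" by (auto simp: nsets_def)
  then show ?case by (simp add: omega_def)
next
  case (insert A F)
  have "(\<Sum>B\<in>F. card (B \<inter> A)) = (\<Sum>B\<in>F. card (A \<inter> B))"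
    by (simp add: Int_commute)
  with insert show ?case
    by (simp add: omega_insert sum.distrib)
qed

text \<open>
  Both sides count the triples \<open>(A, B, i)\<close> with \<open>A, B \<in> F\<close> and \<open>i \<in> A \<inter> B\<close>; the triples with
  \<open>A = B\<close> account for \<open>k |F|\<close>.
\<close>

lemma square_sum_eq_omega:
  assumes "finite V" "F \<subseteq> nsets V k"
  shows "square_sum V F = 2 * real (omega F) + real k * real (card F)"
proof -
  have fin: "finite F" using assms finite_family by blast
  have sub: "A \<subseteq> V" "finite A" "card A = k" if "A \<in> F" for A
    using that assms(2) by (auto simp: nsets_def)
  have "square_sum V F = (\<Sum>i\<in>V. degree F i * real (degree F i))"
    by (simp add: square_sum_def power2_eq_square)
  also have "\<dots> = (\<Sum>B\<in>F. \<Sum>i\<in>B. real (degree F i))"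
    using sum_members_eq_sum_degree[OF assms(1) fin sub(1), of "\<lambda>i. real (degree F i)"] by simp
  also have "\<dots> = (\<Sum>B\<in>F. \<Sum>A\<in>F. real (card (A \<inter> B)))"
  proof (intro sum.cong refl)
    fix B assume B: "B \<in> F"
    have "(\<Sum>i\<in>B. real (degree F i)) = (\<Sum>i\<in>B. \<Sum>A | A \<in> F \<and> i \<in> A. 1)"
      by (simp add: degree_def)
    also have "\<dots> = (\<Sum>A\<in>F. \<Sum>i | i \<in> B \<and> i \<in> A. 1)"
      using fin sub(2)[OF B] by (intro sum.swap_restrict)
    also have "\<dots> = (\<Sum>A\<in>F. real (card (A \<inter> B)))"
      by (intro sum.cong) (auto intro!: arg_cong[where f=card])
    finally show "(\<Sum>i\<in>B. real (degree F i)) = (\<Sum>A\<in>F. real (card (A \<inter> B)))" .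
  qed
  also have "\<dots> = real (\<Sum>A\<in>F. \<Sum>B\<in>F. card (A \<inter> B))"
    by (simp add: Int_commute)
  also have "\<dots> = 2 * real (omega F) + real (\<Sum>A\<in>F. card A)"
    by (simp flip: omega_ordered_pairs[OF fin])
  also have "(\<Sum>A\<in>F. card A) = k * card F"
    using sub(3) by simp
  finally show ?thesis by simp
qed

section \<open>Degrees and codegrees in the complete uniform family\<close>

lemma card_nsets_containing:
  assumes "finite V" "T \<subseteq> V" "card T \<le> k"
  shows "card {A \<in> nsets V k. T \<subseteq> A} = (card V - card T) choose (k - card T)"
proof -
  have finT: "finite T" using assms finite_subset by blast
  have "bij_betw (\<lambda>A. A - T) {A \<in> nsets V k. T \<subseteq> A} (nsets (V - T) (k - card T))"
  proof (rule bij_betw_byWitness[where f' = "\<lambda>B. B \<union> T"])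
    show "(\<lambda>A. A - T) ` {A \<in> nsets V k. T \<subseteq> A} \<subseteq> nsets (V - T) (k - card T)"
      using finT by (auto simp: nsets_def card_Diff_subset)
    show "(\<lambda>B. B \<union> T) ` nsets (V - T) (k - card T) \<subseteq> {A \<in> nsets V k. T \<subseteq> A}"
    proof clarsimp
      fix B assume B: "B \<in> nsets (V - T) (k - card T)"
      then have "card (B \<union> T) = k"
        using finT assms(3) by (subst card_Un_disjoint) (auto simp: nsets_def)
      with B show "B \<union> T \<in> nsets V k"
        using assms finT by (auto simp: nsets_def)
    qed
  qed (auto simp: nsets_def)
  then have "card {A \<in> nsets V k. T \<subseteq> A} = card (nsets (V - T) (k - card T))"
    by (rule bij_betw_same_card)
  then show ?thesis
    using assms finT by (simp add: card_Diff_subset)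
qed

lemma degree_nsets:
  assumes "finite V" "i \<in> V" "k > 0"
  shows "degree (nsets V k) i = (card V - 1) choose (k - 1)"
  using card_nsets_containing[of V "{i}" k] assms by (simp add: degree_def)

text \<open>
  The codegree of a pair is \<open>C(n - 2, k - 2)\<close>. It is stated through its ratio \<open>(k - 1) / (n - 1)\<close>
  to the degree of a point: this is what the size estimates use, and it remains correct for
  \<open>k = 1\<close>, where the truncated \<open>k - 2\<close> would give \<open>1\<close> instead of \<open>0\<close>.
\<close>

lemma codegree_nsets:
  assumes "finite V" "i \<in> V" "j \<in> V" "i \<noteq> j" "k > 0"
  shows "degree {A \<in> nsets V k. i \<in> A} j * (card V - 1) = (k - 1) * ((card V - 1) choose (k - 1))"
proof -
  have eq: "{A \<in> {A \<in> nsets V k. i \<in> A}. j \<in> A} = {A \<in> nsets V k. {i, j} \<subseteq> A}" by auto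
  show ?thesis
  proof (cases "k = 1")
    case True
    have "{A \<in> {A \<in> nsets V k. i \<in> A}. j \<in> A} = {}"
      using True assms(4) by (auto simp: nsets_def card_1_singleton_iff)
    then have "degree {A \<in> nsets V k. i \<in> A} j = 0"
      unfolding degree_def by (metis card.empty)
    then show ?thesis using True by simp
  next
    case False
    then obtain l where l: "k = Suc (Suc l)" using assms(5) by (cases k; cases "k - 1") auto
    have "card {i, j} \<le> card V" using assms by (intro card_mono) auto
    then obtain v where v: "card V = Suc (Suc v)"
      using assms(4) by (cases "card V"; cases "card V - 1") auto
    have "card {A \<in> nsets V k. {i, j} \<subseteq> A} = (card V - 2) choose (k - 2)"
      using card_nsets_containing[of V "{i, j}" k] assms l by (simp add: numeral_2_eq_2)
    then show ?thesis
      using Suc_times_binomial_eq[of v l] by (simp add: degree_def eq l v mult.commute)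
  qed
qed

section \<open>Families meeting a fixed set maximise the sum of squared degrees\<close>

text \<open>
  Give \<open>A \<in> H\<close> the weight \<open>w(A) = \<Sum>\<^bsub>i\<in>A\<^esub> d(i)\<close>. The weights add up to the sum of squared degrees,
  so by Cauchy-Schwarz its square is at most \<open>|H| \<Sum>\<^sub>A w(A)\<^sup>2\<close>. Expanding,
  \<open>\<Sum>\<^sub>A w(A)\<^sup>2 = \<Sum>\<^sub>i\<^sub>,\<^sub>j d(i) d(j) d(i, j)\<close>, where \<open>d(i, j)\<close> is the number of members containing
  both \<open>i\<close> and \<open>j\<close>. The diagonal carries the factor \<open>d(i, i) = d(i) \<le> x\<close>, and everything else is
  damped by the small codegree bound \<open>E\<close>. The codegree \<open>d(i, j)\<close> appears as the degree of
  \<open>j\<close> in the subfamily of members that contain \<open>i\<close>.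
\<close>

lemma square_sum_power2_le:
  fixes E x :: real
  assumes V: "finite V" and H: "H \<subseteq> nsets V k"
    and deg: "\<And>i. i \<in> V \<Longrightarrow> degree H i \<le> x"
    and codeg: "\<And>i j. i \<in> V \<Longrightarrow> j \<in> V \<Longrightarrow> i \<noteq> j \<Longrightarrow> degree {A \<in> H. i \<in> A} j \<le> E"
    and E: "E \<ge> 0"
  shows "(square_sum V H)\<^sup>2 \<le> card H * (x * square_sum V H + E * (real k * real (card H))\<^sup>2)"
proof -
  define d where "d i = real (degree H i)" for i
  define w where "w A = (\<Sum>i\<in>A. d i)" for A
  have fin: "finite H" using V H finite_family by blast
  have sub: "A \<subseteq> V" if "A \<in> H" for A
    using that H by (auto simp: nsets_def)
  have S: "square_sum V H = (\<Sum>A\<in>H. w A)"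
    using sum_members_eq_sum_degree[OF V fin sub, of d]
    by (simp add: w_def square_sum_def d_def power2_eq_square)
  have sumd: "(\<Sum>i\<in>V. d i) = k * card H"
    using sum_degree[OF V H] by (simp add: d_def)
  have star: "(\<Sum>A | A \<in> H \<and> i \<in> A. w A) \<le> d i * x + E * (k * card H)" if i: "i \<in> V" for i
  proof -
    have "(\<Sum>A | A \<in> H \<and> i \<in> A. w A) = (\<Sum>j\<in>V. degree {A \<in> H. i \<in> A} j * d j)"
      unfolding w_def using fin sub V by (intro sum_members_eq_sum_degree) auto
    also have "\<dots> = degree {A \<in> H. i \<in> A} i * d i + (\<Sum>j\<in>V - {i}. degree {A \<in> H. i \<in> A} j * d j)"
      using i V by (simp add: sum.remove)
    also have "\<dots> \<le> x * d i + (\<Sum>j\<in>V - {i}. E * d j)"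
    proof (intro add_mono sum_mono mult_right_mono)
      have "degree {A \<in> H. i \<in> A} i = degree H i" by (simp add: degree_def)
      then show "degree {A \<in> H. i \<in> A} i \<le> x" using deg i by simp
    qed (use codeg i in \<open>auto simp: d_def\<close>)
    also have "(\<Sum>j\<in>V - {i}. E * d j) \<le> (\<Sum>j\<in>V. E * d j)"
      using V E by (intro sum_mono2) (auto simp: d_def)
    also have "(\<Sum>j\<in>V. E * d j) = E * (k * card H)"
      by (simp add: sumd flip: sum_distrib_left)
    finally show ?thesis by (simp add: mult.commute)
  qed
  have "(\<Sum>A\<in>H. (w A)\<^sup>2) = (\<Sum>A\<in>H. \<Sum>i | i \<in> V \<and> i \<in> A. d i * w A)"
  proof (intro sum.cong refl)
    fix A assume "A \<in> H"
    then have "{i. i \<in> V \<and> i \<in> A} = A" using sub by auto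
    then show "(w A)\<^sup>2 = (\<Sum>i | i \<in> V \<and> i \<in> A. d i * w A)"
      by (simp add: w_def power2_eq_square flip: sum_distrib_right)
  qed
  also have "\<dots> = (\<Sum>i\<in>V. \<Sum>A | A \<in> H \<and> i \<in> A. d i * w A)"
    using fin V by (intro sum.swap_restrict)
  also have "\<dots> \<le> (\<Sum>i\<in>V. d i * (d i * x + E * (k * card H)))"
    unfolding sum_distrib_left[symmetric]
    by (intro sum_mono mult_left_mono star) (simp_all add: d_def)
  also have "\<dots> = x * square_sum V H + E * (k * card H) * (\<Sum>i\<in>V. d i)"
    by (simp add: algebra_simps sum.distrib sum_distrib_left square_sum_def d_def power2_eq_square)
  also have "\<dots> = x * square_sum V H + E * (k * card H)\<^sup>2"
    by (simp add: sumd power2_eq_square)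
  finally have w2: "(\<Sum>A\<in>H. (w A)\<^sup>2) \<le> x * square_sum V H + E * (k * card H)\<^sup>2" .
  have "(\<Sum>A\<in>H. w A)\<^sup>2 \<le> (\<Sum>A\<in>H. (w A)\<^sup>2) * card H"
    by (rule sum_squared_le_sum_of_squares)
  also have "\<dots> \<le> (x * square_sum V H + E * (k * card H)\<^sup>2) * card H"
    using w2 by (intro mult_right_mono) auto
  finally show ?thesis by (simp add: S mult_ac)
qed

lemma card_meeting_le:
  fixes D :: real
  assumes "finite R" "\<And>i. i \<in> R \<Longrightarrow> real (degree F i) \<le> D"
  shows "real (card {A \<in> F. A \<inter> R \<noteq> {}}) \<le> card R * D"
proof -
  have "{A \<in> F. A \<inter> R \<noteq> {}} = (\<Union>i\<in>R. {A \<in> F. i \<in> A})" by auto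
  then have "card {A \<in> F. A \<inter> R \<noteq> {}} \<le> (\<Sum>i\<in>R. degree F i)"
    using card_UN_le[OF assms(1)] by (simp add: degree_def)
  then have "real (card {A \<in> F. A \<inter> R \<noteq> {}}) \<le> (\<Sum>i\<in>R. real (degree F i))"
    by (simp flip: of_nat_sum)
  also have "\<dots> \<le> card R * D"
    using sum_bounded_above[of R "\<lambda>i. real (degree F i)" D] assms(2) by simp
  finally show ?thesis .
qed

text \<open>
  The number \<open>x\<close> separates the degrees on \<open>R\<close> from those outside, so \<open>R\<close> consists of points of
  largest degree. Exchanging the sets \<open>H\<close> that avoid \<open>R\<close> for the missing sets \<open>K\<close> that meet \<open>R\<close>
  gains at least \<open>D + x\<close> per set added, and costs on average less than \<open>D + x\<close> per set removed:
  \<open>x + D / 2\<close> bounds the part that comes from the degrees within \<open>H\<close>, and \<open>D / 2\<close> the part that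
  comes from sets meeting \<open>R\<close>.
\<close>

lemma square_sum_less_meeting:
  fixes D E x :: real
  assumes V: "finite V" and F: "F \<subseteq> nsets V k" and R: "R \<subseteq> V" and k: "k > 0"
    and card: "card F = card (meeting V k R)"
    and D: "\<And>i. i \<in> V \<Longrightarrow> degree (nsets V k) i = D"
    and E: "E \<ge> 0"
      "\<And>i j. i \<in> V \<Longrightarrow> j \<in> V \<Longrightarrow> i \<noteq> j \<Longrightarrow> degree {A \<in> nsets V k. i \<in> A} j \<le> E"
    and ED: "4 * k\<^sup>2 * card R * E < D"
    and x: "\<And>i. i \<in> R \<Longrightarrow> x \<le> degree F i" "\<And>i. i \<in> V - R \<Longrightarrow> degree F i \<le> x"
    and ne: "F \<noteq> meeting V k R"
  shows "square_sum V F < square_sum V (meeting V k R)"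
proof -
  let ?G = "meeting V k R"
  define H where "H = F - ?G"
  define K where "K = ?G - F"
  define a where "a = real (card H)"
  define r where "r = real (card R)"
  have G: "?G \<subseteq> nsets V k" by (auto simp: meeting_def)
  note fin = finite_family[OF V]
  have fins: "finite F" "finite ?G" "finite R" using fin F G R V finite_subset by blast+
  have HK: "H \<subseteq> nsets V k" "K \<subseteq> nsets V k" using F G by (auto simp: H_def K_def)
  have finHK: "finite H" "finite K" using HK fin by blast+
  have cardHK: "card H = card K"
    unfolding H_def K_def using card fins
    by (metis card_Diff_subset_Int finite_Int inf_commute)
  have "H \<noteq> {}"
  proof
    assume "H = {}"
    then have "F \<subseteq> ?G" by (auto simp: H_def)
    with card ne fins show False by (metis card_subset_eq)
  qed
  then have a: "a > 0" using finHK by (simp add: a_def card_gt_0_iff)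
  have Dpos: "D > 0"
    using ED E(1) by (smt (verit) mult_nonneg_nonneg of_nat_0_le_iff zero_le_power2)
  have degF: "real (degree F i) = real (degree (F \<inter> ?G) i) + degree H i" for i
  proof -
    have "(F \<inter> ?G) \<union> H = F" by (auto simp: H_def)
    then show ?thesis
      using degree_Un[of "F \<inter> ?G" H i] fins by (simp add: H_def disjoint_iff)
  qed
  have degG: "real (degree ?G i) = real (degree (F \<inter> ?G) i) + degree K i" for i
  proof -
    have "(F \<inter> ?G) \<union> K = ?G" by (auto simp: K_def)
    then show ?thesis
      using degree_Un[of "F \<inter> ?G" K i] fins by (simp add: K_def disjoint_iff)
  qed
  have Hout: "degree H i = 0" if "i \<in> R" for i
  proof (rule ccontr)
    assume "degree H i \<noteq> 0"
    then obtain A where "A \<in> H" "i \<in> A" using degree_pos_D by fast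
    then show False using that F by (auto simp: H_def meeting_def)
  qed
  have Gin: "degree ?G i = D" if "i \<in> R" for i
  proof -
    have "{A \<in> ?G. i \<in> A} = {A \<in> nsets V k. i \<in> A}" using that by (auto simp: meeting_def)
    then have "degree ?G i = degree (nsets V k) i" by (simp add: degree_def)
    then show ?thesis using D that R by auto
  qed
  have Gout: "degree ?G i \<le> r * E" if "i \<in> V - R" for i
  proof -
    have "real (card {A \<in> {A \<in> nsets V k. i \<in> A}. A \<inter> R \<noteq> {}}) \<le> card R * E"
      by (rule card_meeting_le) (use that R fins E(2) in auto)
    moreover have "{A \<in> {A \<in> nsets V k. i \<in> A}. A \<inter> R \<noteq> {}} = {A \<in> ?G. i \<in> A}"
      by (auto simp: meeting_def)
    ultimately show ?thesis by (simp add: degree_def r_def)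
  qed
  have ale: "a \<le> r * D"
  proof -
    have "a \<le> card ?G" unfolding a_def cardHK K_def using fins by (simp add: card_mono)
    also have "\<dots> \<le> r * D"
      unfolding meeting_def r_def using D R fins(3) by (intro card_meeting_le) (auto simp: subset_iff)
    finally show ?thesis .
  qed
  \<comment> \<open>The factor \<open>d\<^sub>G - d\<^sub>F\<close> equals \<open>d\<^sub>K - d\<^sub>H\<close>, since the members of \<open>F \<inter> G\<close> cancel.\<close>
  have "square_sum V ?G - square_sum V F
      = (\<Sum>i\<in>V. (real (degree ?G i) - degree F i) * (real (degree ?G i) + degree F i))"
    by (simp add: square_sum_def sum_subtractf power2_eq_square square_diff_square_factored
        flip: sum_subtractf) (simp add: algebra_simps)
  also have "\<dots> = (\<Sum>i\<in>V. degree K i * (real (degree ?G i) + degree F i))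
      - (\<Sum>i\<in>V. degree H i * (real (degree ?G i) + degree F i))"
    by (simp add: degF degG sum_subtractf[symmetric] algebra_simps)
  finally have diff: "square_sum V ?G - square_sum V F = \<dots>" .

  have "a * (D + x) \<le> (\<Sum>A\<in>K. \<Sum>i\<in>A. real (degree ?G i) + degree F i)"
  proof -
    have "D + x \<le> (\<Sum>i\<in>A. real (degree ?G i) + degree F i)" if "A \<in> K" for A
    proof -
      from that obtain i where i: "i \<in> A" "i \<in> R" and A: "finite A"
        by (auto simp: K_def meeting_def nsets_def)
      have "D + x \<le> real (degree ?G i) + degree F i"
        using Gin x(1) i(2) by simp
      also have "\<dots> \<le> (\<Sum>i\<in>A. real (degree ?G i) + degree F i)"
        using i A by (intro member_le_sum) auto
      finally show ?thesis .
    qed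
    then show ?thesis
      using sum_bounded_below[of K "D + x"] by (simp add: a_def cardHK)
  qed
  also have "\<dots> = (\<Sum>i\<in>V. degree K i * (real (degree ?G i) + degree F i))"
    using HK(2) finHK by (intro sum_members_eq_sum_degree V) (auto simp: nsets_def)
  finally have Kpart: "a * (D + x) \<le> \<dots>" .

  have "(\<Sum>i\<in>V. degree H i * (real (degree ?G i) + degree F i))
      \<le> (\<Sum>i\<in>V. degree H i * (2 * (r * E) + degree H i))"
  proof (intro sum_mono)
    fix i assume i: "i \<in> V"
    show "degree H i * (real (degree ?G i) + degree F i) \<le> degree H i * (2 * (r * E) + degree H i)"
    proof (cases "i \<in> R")
      case False
      then have "real (degree ?G i) + degree F i \<le> 2 * (r * E) + degree H i"
        using Gout[of i] degF[of i] degG[of i] i by simp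
      then show ?thesis by (intro mult_left_mono) auto
    qed (simp add: Hout)
  qed
  also have "\<dots> = 2 * (r * E) * (\<Sum>i\<in>V. degree H i) + square_sum V H"
    by (simp add: algebra_simps sum.distrib sum_distrib_left square_sum_def power2_eq_square)
  also have "\<dots> = 2 * (r * E) * (k * a) + square_sum V H"
    using sum_degree[OF V HK(1)] by (simp add: a_def)
  finally have Hpart: "(\<Sum>i\<in>V. degree H i * (real (degree ?G i) + degree F i)) \<le> \<dots>" .

  have "r * E * (2 * k) \<le> D / 2"
  proof -
    have "r * E * k \<le> r * E * (real k)\<^sup>2"
      using k E(1) by (intro mult_left_mono) (auto simp: power2_eq_square r_def)
    then show ?thesis using ED by (simp add: r_def algebra_simps)
  qed
  then have small: "2 * (r * E) * (k * a) \<le> a * (D / 2)"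
    using mult_left_mono[of "r * E * (2 * k)" "D / 2" a] a by (simp add: algebra_simps)

  have x0: "x \<ge> 0"
  proof -
    obtain A where "A \<in> H" using \<open>H \<noteq> {}\<close> by auto
    then have "A \<subseteq> V - R" "A \<noteq> {}" using F k by (auto simp: H_def meeting_def nsets_def)
    then obtain j where "j \<in> V - R" by auto
    then show ?thesis using x(2)[of j] by linarith
  qed
  have degH: "degree H i \<le> x" if i: "i \<in> V" for i
  proof (cases "i \<in> R")
    case True
    then show ?thesis using x0 Hout by simp
  next
    case False
    then show ?thesis using i x(2)[of i] degF[of i] by auto
  qed
  have sq: "(square_sum V H)\<^sup>2 \<le> a * (x * square_sum V H + E * (k * a)\<^sup>2)"
    unfolding a_def
  proof (rule square_sum_power2_le[OF V HK(1) degH])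
    fix i j assume ij: "i \<in> V" "j \<in> V" "i \<noteq> j"
    have "degree {A \<in> H. i \<in> A} j \<le> degree {A \<in> nsets V k. i \<in> A} j"
      using HK(1) finite_nsets[OF V] by (intro degree_mono) auto
    then show "degree {A \<in> H. i \<in> A} j \<le> E" using E(2)[OF ij] by simp
  qed (use E in auto)
  \<comment> \<open>Otherwise \<open>s (s - a x) \<ge> (a D / 2)\<^sup>2\<close>, while the previous bound gives
    \<open>s (s - a x) \<le> a E (k a)\<^sup>2\<close>; with \<open>a \<le> r D\<close> this contradicts \<open>4 k\<^sup>2 r E < D\<close>.\<close>
  have "square_sum V H < a * (x + D / 2)"
  proof (rule ccontr)
    let ?s = "square_sum V H"
    assume "\<not> ?thesis"
    then have s: "?s - a * x \<ge> a * (D / 2)" by (simp add: algebra_simps)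
    have "a * x \<ge> 0" "a * (D / 2) \<ge> 0" using a x0 Dpos by simp_all
    then have "?s \<ge> a * (D / 2)" "?s \<ge> 0" using s by linarith+
    then have "(a * (D / 2)) * (a * (D / 2)) \<le> ?s * (?s - a * x)"
      using s a Dpos by (intro mult_mono) auto
    also have "\<dots> \<le> a * E * (k * a)\<^sup>2"
      using sq by (simp add: algebra_simps power2_eq_square)
    finally have "a\<^sup>2 * D\<^sup>2 \<le> a\<^sup>2 * (4 * k\<^sup>2 * E * a)"
      by (simp add: algebra_simps power2_eq_square)
    then have "D\<^sup>2 \<le> 4 * k\<^sup>2 * E * a" using a by simp
    also have "\<dots> \<le> 4 * k\<^sup>2 * E * (r * D)"
      using ale E(1) by (intro mult_left_mono) auto
    finally have "D * D \<le> (4 * k\<^sup>2 * card R * E) * D"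
      by (simp add: power2_eq_square r_def algebra_simps)
    then show False using ED Dpos by simp
  qed
  with diff Kpart Hpart small show ?thesis by (simp add: algebra_simps)
qed

lemma ex_top_subset:
  fixes f :: "'a \<Rightarrow> 'b::linorder"
  assumes "finite V" "r \<le> card V"
  shows "\<exists>R \<subseteq> V. card R = r \<and> (\<forall>i\<in>R. \<forall>j\<in>V - R. f j \<le> f i)"
  using assms(2)
proof (induction r)
  case 0
  show ?case by (intro exI[of _ "{}"]) auto
next
  case (Suc r)
  then obtain R where R: "R \<subseteq> V" "card R = r" "\<forall>i\<in>R. \<forall>j\<in>V - R. f j \<le> f i" by auto
  have ne: "V - R \<noteq> {}" using R Suc.prems by auto
  have fin: "finite (V - R)" "finite R" using assms(1) R(1) finite_subset by auto
  have "Max (f ` (V - R)) \<in> f ` (V - R)" using ne fin by (intro Max_in) auto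
  then obtain m where m: "m \<in> V - R" "f m = Max (f ` (V - R))" by auto
  have "\<forall>j\<in>V - R. f j \<le> f m" using m fin by simp
  then show ?case
    using R m fin by (intro exI[of _ "insert m R"]) auto
qed

lemma card_meeting:
  assumes "finite V" "R \<subseteq> V"
  shows "card (meeting V k R) = (card V choose k) - ((card V - card R) choose k)"
proof -
  have "meeting V k R = nsets V k - nsets (V - R) k"
    by (auto simp: meeting_def nsets_def)
  moreover have "nsets (V - R) k \<subseteq> nsets V k" by (intro nsets_mono) auto
  moreover have "finite R" using assms finite_subset by blast
  ultimately show ?thesis
    using assms by (simp add: card_Diff_subset finite_nsets)
qed

text \<open>
  Since \<open>E = (k - 1) D / (n - 1)\<close>, the condition \<open>4 k\<^sup>2 r E < D\<close> of the exchange argument is the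
  inequality between \<open>n\<close>, \<open>k\<close> and \<open>r\<close> assumed here.
\<close>

lemma square_sum_le_meeting:
  assumes V: "finite V" and F: "F \<subseteq> nsets V k" and k: "k > 0" and r: "0 < r" "r \<le> card V"
    and large: "4 * k\<^sup>2 * (k - 1) * r < card V - 1"
    and card: "card F = (card V choose k) - ((card V - r) choose k)"
  shows "\<exists>R\<subseteq>V. card R = r \<and>
           (F = meeting V k R \<or> square_sum V F < square_sum V (meeting V k R))"
proof -
  obtain R where R: "R \<subseteq> V" "card R = r" "\<forall>i\<in>R. \<forall>j\<in>V - R. degree F j \<le> degree F i"
    using ex_top_subset[OF V r(2), of "degree F"] by auto
  have finR: "finite R" "R \<noteq> {}" using R V r finite_subset by auto
  define D where "D = real ((card V - 1) choose (k - 1))"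
  define E where "E = (k - 1) * D / (card V - 1)"
  have n1: "real (card V - 1) > 0" using large by simp
  have "(k - 1) * 1 \<le> (k - 1) * (4 * k\<^sup>2 * r)"
    using k r by (intro mult_le_mono2) (simp add: Suc_le_eq)
  also have "\<dots> = 4 * k\<^sup>2 * (k - 1) * r" by (simp only: mult_ac)
  finally have "k - 1 \<le> card V - 1" using large by linarith
  then have D: "D > 0" by (simp add: D_def)
  have codeg: "degree {A \<in> nsets V k. i \<in> A} j \<le> E" if "i \<in> V" "j \<in> V" "i \<noteq> j" for i j
  proof -
    have "real (degree {A \<in> nsets V k. i \<in> A} j) * real (card V - 1) = real (k - 1) * D"
      using codegree_nsets[OF V that k] unfolding D_def by (metis of_nat_mult)
    then show ?thesis using n1 by (simp add: E_def field_simps)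
  qed
  have "real (4 * k\<^sup>2 * (k - 1) * r) * D < real (card V - 1) * D"
    using large D by (intro mult_strict_right_mono) (simp_all only: of_nat_less_iff)
  then have "4 * k\<^sup>2 * card R * E < D"
    using n1 by (simp add: E_def R(2) divide_less_eq mult_ac)
  moreover have "E \<ge> 0" using D by (simp add: E_def)
  moreover have "card F = card (meeting V k R)" using card card_meeting[OF V R(1)] R(2) by simp
  moreover have "real (Min (degree F ` R)) \<le> degree F i" if "i \<in> R" for i
    using that finR by simp
  moreover have "degree F j \<le> real (Min (degree F ` R))" if "j \<in> V - R" for j
    using that finR R(3) by simp
  ultimately have "F \<noteq> meeting V k R \<Longrightarrow> square_sum V F < square_sum V (meeting V k R)"
    using degree_nsets[OF V _ k] codeg
    by (intro square_sum_less_meeting[OF V F R(1) k, where D = D and E = E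
        and x = "real (Min (degree F ` R))"]) (auto simp: D_def)
  then show ?thesis using R by auto
qed

section \<open>Initial segments of the lexicographic order\<close>

lemma lex_less_if_meets:
  assumes "A \<in> nsets {1..n} k" "B \<in> nsets {1..n} k" "A \<inter> {1..r} \<noteq> {}" "B \<inter> {1..r} = {}"
  shows "lex_less A B"
proof -
  have fin: "finite A" "finite B" and c: "card A = card B"
    using assms by (auto simp: nsets_def)
  have "\<not> B \<subseteq> A"
    using card_subset_eq[OF fin(1)] c assms by auto
  then have "Min (B - A) \<in> B - A" using fin by (intro Min_in) auto
  then have "Min (B - A) > r" using assms by (auto simp: nsets_def subset_iff disjoint_iff)
  moreover obtain i where "i \<in> A - B" "i \<le> r" using assms(3,4) by fastforce
  then have "Min (A - B) \<le> r" using fin by (meson Min_le finite_Diff order_trans)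
  ultimately show ?thesis by (simp add: lex_less_def)
qed

text \<open>
  A set that meets \<open>{1..r}\<close> precedes every set that does not. So the predecessors of a set
  meeting \<open>{1..r}\<close> are among the other sets that meet it, hence fewer than there are
  such sets, while a set that avoids \<open>{1..r}\<close> is preceded by all of them.
\<close>

lemma lex_initial_eq_meeting:
  assumes "r \<le> n"
  shows "lex_initial n k ((n choose k) - ((n - r) choose k)) = meeting {1..n} k {1..r}"
proof -
  let ?U = "nsets {1..n} k" and ?G = "meeting {1..n} k {1..r}"
  let ?m = "(n choose k) - ((n - r) choose k)"
  have cG: "card ?G = ?m" using card_meeting[of "{1..n}" "{1..r}" k] assms by simp
  have finU: "finite ?U" by (simp add: finite_nsets)
  have finG: "finite ?G" by (rule finite_subset[OF _ finU]) (auto simp: meeting_def)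
  have "card {B \<in> ?U. lex_less B A} < ?m \<longleftrightarrow> A \<in> ?G" if A: "A \<in> ?U" for A
  proof
    assume "card {B \<in> ?U. lex_less B A} < ?m"
    show "A \<in> ?G"
    proof (rule ccontr)
      assume "A \<notin> ?G"
      then have "?G \<subseteq> {B \<in> ?U. lex_less B A}"
        using A lex_less_if_meets[of _ n k A r] unfolding meeting_def by blast
      then have "card ?G \<le> card {B \<in> ?U. lex_less B A}"
        using finU by (intro card_mono) auto
      with cG \<open>card _ < ?m\<close> show False by simp
    qed
  next
    assume AG: "A \<in> ?G"
    have "B \<in> ?G - {A}" if B: "B \<in> ?U" "lex_less B A" for B
    proof -
      have "\<not> lex_less A B" using B(2) by (auto simp: lex_less_def)
      then show ?thesis using lex_less_if_meets[OF A B(1)] AG B by (auto simp: meeting_def)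
    qed
    then have "{B \<in> ?U. lex_less B A} \<subset> ?G" using AG by blast
    then show "card {B \<in> ?U. lex_less B A} < ?m"
      using psubset_card_mono[OF finG] cG by simp
  qed
  then show ?thesis by (auto simp: lex_initial_def meeting_def)
qed


section \<open>Isomorphic families\<close>

lemma square_sum_image:
  assumes p: "p permutes V"
  shows "square_sum V ((\<lambda>A. p ` A) ` F) = square_sum V F"
proof -
  have inj: "inj p" using p permutes_inj by blast
  have deg: "degree ((\<lambda>A. p ` A) ` F) (p i) = degree F i" for i
  proof -
    have "p i \<in> p ` A \<longleftrightarrow> i \<in> A" for A
      using inj by (rule inj_image_mem_iff)
    then have "{B \<in> (\<lambda>A. p ` A) ` F. p i \<in> B} = (\<lambda>A. p ` A) ` {A \<in> F. i \<in> A}"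
      by blast
    moreover have "inj_on (\<lambda>A. p ` A) {A \<in> F. i \<in> A}"
      using inj by (auto simp: inj_on_def inj_image_eq_iff)
    ultimately show ?thesis by (simp add: degree_def card_image)
  qed
  have "square_sum V ((\<lambda>A. p ` A) ` F)
      = (\<Sum>i\<in>p ` V. (real (degree ((\<lambda>A. p ` A) ` F) i))\<^sup>2)"
    using p by (simp add: square_sum_def permutes_image)
  also have "\<dots> = square_sum V F"
    using p by (subst sum.reindex) (auto simp: permutes_inj_on square_sum_def deg)
  finally show ?thesis .
qed

lemma image_nsets_permutes:
  assumes "p permutes V"
  shows "(\<lambda>A. p ` A) ` nsets V k = nsets V k"
proof -
  have sub: "(\<lambda>A. q ` A) ` nsets V k \<subseteq> nsets V k" if "q permutes V" for q
    using permutes_image[OF that] permutes_inj_on[OF that]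
    by (auto simp: nsets_def card_image)
  have "A \<in> (\<lambda>A. p ` A) ` nsets V k" if "A \<in> nsets V k" for A
  proof
    show "A = p ` (inv p ` A)"
      using permutes_surj[OF assms] by (simp add: image_f_inv_f)
    show "inv p ` A \<in> nsets V k"
      using sub[OF permutes_inv[OF assms]] that by auto
  qed
  with sub[OF assms] show ?thesis by auto
qed

lemma omega_family_iso:
  assumes "F \<subseteq> nsets {1..n} k" "family_iso n F G"
  shows "omega F = omega G"
proof -
  obtain p where p: "p permutes {1..n}" "G = (\<lambda>A. p ` A) ` F"
    using assms(2) by (auto simp: family_iso_def)
  have "card G = card F"
    unfolding p(2) using permutes_inj[OF p(1)]
    by (intro card_image) (auto simp: inj_on_def inj_image_eq_iff)
  moreover have "G \<subseteq> nsets {1..n} k"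
    using image_nsets_permutes[OF p(1), of k] assms(1) p(2) by auto
  moreover have "square_sum {1..n} G = square_sum {1..n} F"
    using square_sum_image p by simp
  ultimately show ?thesis
    using square_sum_eq_omega[of "{1..n}" F k] square_sum_eq_omega[of "{1..n}" G k] assms(1)
    by simp
qed

lemma family_iso_Diff:
  assumes "F \<subseteq> nsets {1..n} k" "G \<subseteq> nsets {1..n} k"
  shows "family_iso n (nsets {1..n} k - F) (nsets {1..n} k - G) \<longleftrightarrow> family_iso n F G"
proof -
  have imp: "family_iso n (nsets {1..n} k - F) (nsets {1..n} k - G)" if iso: "family_iso n F G" for F G
  proof -
    obtain p where p: "p permutes {1..n}" "(\<lambda>A. p ` A) ` F = G"
      using iso by (auto simp: family_iso_def)
    have "inj (\<lambda>A. p ` A)"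
      using permutes_inj[OF p(1)] by (auto simp: inj_on_def inj_image_eq_iff)
    then have "(\<lambda>A. p ` A) ` (nsets {1..n} k - F) = nsets {1..n} k - G"
      using image_nsets_permutes[OF p(1), of k] p(2) by (simp only: image_set_diff)
    then show ?thesis using p(1) unfolding family_iso_def by blast
  qed
  show ?thesis
    using imp[of F G] imp[of "nsets {1..n} k - F" "nsets {1..n} k - G"] assms
    by (auto simp: double_diff)
qed

text \<open>
  Any two bijections \<open>R \<rightarrow> T\<close> and \<open>V - R \<rightarrow> V - T\<close> combine to such a permutation.
\<close>

lemma ex_permutes_image_eq:
  assumes "finite V" "R \<subseteq> V" "T \<subseteq> V" "card R = card T"
  shows "\<exists>p. p permutes V \<and> p ` R = T"
proof -
  have fin: "finite R" "finite T" using assms finite_subset by auto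
  obtain f where f: "bij_betw f R T"
    using finite_same_card_bij[OF fin assms(4)] by auto
  have "card (V - R) = card (V - T)" using assms fin by (simp add: card_Diff_subset)
  then obtain g where g: "bij_betw g (V - R) (V - T)"
    using finite_same_card_bij assms(1) by (metis finite_Diff)
  define p where "p x = (if x \<in> R then f x else if x \<in> V then g x else x)" for x
  have "bij_betw p R T" using f by (subst bij_betw_cong[of _ _ f]) (auto simp: p_def)
  moreover have "bij_betw p (V - R) (V - T)"
    using g by (subst bij_betw_cong[of _ _ g]) (auto simp: p_def)
  ultimately have "bij_betw p (R \<union> (V - R)) (T \<union> (V - T))"
    by (rule bij_betw_combine) auto
  then have "bij_betw p V V" using assms by (simp add: Un_absorb1)
  then have "p permutes V" using assms(2) by (intro bij_imp_permutes) (auto simp: p_def)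
  then show ?thesis using \<open>bij_betw p R T\<close> bij_betw_imp_surj_on by blast
qed

lemma family_iso_meeting:
  assumes "R \<subseteq> {1..n}" "T \<subseteq> {1..n}" "card R = card T"
  shows "family_iso n (meeting {1..n} k R) (meeting {1..n} k T)"
proof -
  obtain p where p: "p permutes {1..n}" "p ` R = T"
    using ex_permutes_image_eq[OF _ assms] by auto
  have meet: "p ` A \<inter> T \<noteq> {} \<longleftrightarrow> A \<inter> R \<noteq> {}" for A
    using image_Int[OF permutes_inj[OF p(1)], of A R] p(2) by auto
  have "(\<lambda>A. p ` A) ` meeting {1..n} k R = {B \<in> (\<lambda>A. p ` A) ` nsets {1..n} k. B \<inter> T \<noteq> {}}"
    using meet by (auto simp: meeting_def)
  then have "(\<lambda>A. p ` A) ` meeting {1..n} k R = meeting {1..n} k T"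
    unfolding image_nsets_permutes[OF p(1)] by (simp add: meeting_def)
  with p(1) show ?thesis by (auto simp: family_iso_def)
qed

text \<open>
  The optimal set \<open>R\<close> depends on \<open>F\<close>, but all families \<open>meeting {1..n} k R\<close> with \<open>|R| = r\<close>
  are isomorphic and thus have the same \<open>\<omega>\<close>. A family that is not of this form is strictly worse,
  which settles the case of equality.
\<close>

lemma omega_le_meeting:
  assumes F: "F \<subseteq> nsets {1..n} k" and "k > 0" and r: "0 < r" "r \<le> n"
    and large: "4 * k\<^sup>2 * (k - 1) * r < n - 1"
    and card: "card F = (n choose k) - ((n - r) choose k)"
  shows "omega F \<le> omega (meeting {1..n} k {1..r}) \<and>
    (omega F = omega (meeting {1..n} k {1..r}) \<longleftrightarrow> family_iso n F (meeting {1..n} k {1..r}))"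
proof -
  let ?G = "meeting {1..n} k"
  obtain R where R: "R \<subseteq> {1..n}" "card R = r"
    and FR: "F = ?G R \<or> square_sum {1..n} F < square_sum {1..n} (?G R)"
    using square_sum_le_meeting[of "{1..n}" F k r] assms by auto
  have G: "?G R \<subseteq> nsets {1..n} k" by (auto simp: meeting_def)
  have iso: "family_iso n (?G R) (?G {1..r})" using R r by (intro family_iso_meeting) auto
  have eq: "omega (?G R) = omega (?G {1..r})" using omega_family_iso[OF G iso] .
  show ?thesis
  proof (cases "F = ?G R")
    case True
    then show ?thesis using iso eq by simp
  next
    case False
    have "card F = card (?G R)" using card card_meeting[OF _ R(1)] R(2) by simp
    then have "omega F < omega (?G R)"
      using FR False square_sum_eq_omega[OF _ F] square_sum_eq_omega[OF _ G] by simp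
    then show ?thesis using eq omega_family_iso[OF F] by auto
  qed
qed

section \<open>Complementary families\<close>

text \<open>
  The complement of \<open>F\<close> has degrees \<open>D - d(i)\<close>, and
  \<open>\<Sum>\<^sub>i (D - d(i))\<^sup>2 = n D\<^sup>2 - 2 D k |F| + \<Sum>\<^sub>i d(i)\<^sup>2\<close>, where only the last term depends on more than
  the size of \<open>F\<close>.
\<close>

lemma omega_complement_diff:
  assumes F: "F \<subseteq> nsets {1..n} k" and G: "G \<subseteq> nsets {1..n} k" and card: "card F = card G"
    and k: "k > 0"
  shows "real (omega (nsets {1..n} k - F)) - omega F = real (omega (nsets {1..n} k - G)) - omega G"
proof -
  let ?V = "{1..n}" and ?U = "nsets {1..n} k"
  define D where "D = real ((n - 1) choose (k - 1))"
  have comp: "square_sum ?V (?U - F) = n * D\<^sup>2 - 2 * D * (k * card F) + square_sum ?V F"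
    if F: "F \<subseteq> ?U" for F
  proof -
    have "real (degree (?U - F) i) = D - degree F i" if "i \<in> ?V" for i
    proof -
      have "F \<union> (?U - F) = ?U" using F by auto
      then have "degree ?U i = degree F i + degree (?U - F) i"
        using degree_Un[of F "?U - F" i] finite_family[OF _ F] by (simp add: finite_nsets)
      moreover have "degree ?U i = D" using degree_nsets[of ?V i k] that k by (simp add: D_def)
      ultimately show ?thesis by simp
    qed
    then have "square_sum ?V (?U - F) = (\<Sum>i\<in>?V. D\<^sup>2 - 2 * D * degree F i + (degree F i)\<^sup>2)"
      unfolding square_sum_def by (intro sum.cong refl) (simp add: power2_diff)
    also have "\<dots> = n * D\<^sup>2 - 2 * D * (\<Sum>i\<in>?V. degree F i) + square_sum ?V F"
      by (simp add: sum.distrib sum_subtractf square_sum_def sum_distrib_left)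
    finally show ?thesis using sum_degree[of ?V F k] F by simp
  qed
  have "card (?U - F) = card (?U - G)"
    using finite_family[OF _ F] finite_family[OF _ G] F G card by (simp add: card_Diff_subset)
  then show ?thesis
    using comp[OF F] comp[OF G] card
      square_sum_eq_omega[of ?V F k] square_sum_eq_omega[of ?V G k] F G
      square_sum_eq_omega[of ?V "?U - F" k] square_sum_eq_omega[of ?V "?U - G" k] by simp
qed

lemma size_condition_sufficient:
  fixes n k r s :: nat
  assumes "k > 0" and "r > 0" and n: "n > 36 * k * (2 * k + 1) * (k + r) * r\<^sup>2" and "s \<le> r"
  shows "4 * k\<^sup>2 * (k - 1) * s < n - 1 \<and> s \<le> n"
proof -
  define P where "P = k * (2 * k + 1) * (k + r) * r\<^sup>2"
  define Q where "Q = k * k * k * r"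
  have "Q + k * r \<le> k * (2 * k + 1) * (k + r) * r"
  proof -
    have "k * (2 * k + 1) * (k + r) * r = Q + k * k * r + (Q + 2 * k * k * r * r + k * r * r)"
      by (simp add: Q_def algebra_simps)
    moreover have "k * r \<le> k * k * r" using assms(1) by simp
    ultimately show ?thesis by linarith
  qed
  also have "\<dots> \<le> P"
    unfolding P_def using assms(2) by (intro mult_le_mono2) (simp add: power2_eq_square)
  finally have "Q + k * r \<le> P" .
  moreover have "36 * P < n" using n by (simp only: P_def mult.assoc)
  moreover have "1 \<le> k * r" "r \<le> k * r" using assms(1,2) by (simp_all add: Suc_le_eq)
  moreover have "4 * k\<^sup>2 * (k - 1) * s \<le> 4 * Q"
  proof -
    have "4 * k\<^sup>2 * (k - 1) * s \<le> 4 * k\<^sup>2 * k * r" using assms(4) by (intro mult_le_mono) auto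
    also have "\<dots> = 4 * Q" by (simp only: Q_def power2_eq_square mult.assoc)
    finally show ?thesis .
  qed
  ultimately show ?thesis using assms(4) by linarith
qed

theorem corollary1:
  fixes n k r m :: nat and F :: "nat set set"
  assumes "n > 0" and "k > 0" and "r > 0"
    and "n > 36 * k * (2 * k + 1) * (k + r) * r ^ 2"
    and "F \<subseteq> nsets {1..n} k" and "card F = m"
  shows
    "(m \<in> {(n choose k) - ((n - r1) choose k) | r1. 1 \<le> r1 \<and> r1 \<le> r} \<longrightarrow>
        omega F \<le> omega (lex_initial n k m) \<and>
        (omega F = omega (lex_initial n k m) \<longleftrightarrow> family_iso n F (lex_initial n k m)))
     \<and>
     (m \<in> {(n - r1) choose k | r1. 1 \<le> r1 \<and> r1 \<le> r} \<longrightarrow>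
        omega F \<le> omega (nsets {1..n} k - lex_initial n k ((n choose k) - m)) \<and>
        (omega F = omega (nsets {1..n} k - lex_initial n k ((n choose k) - m)) \<longleftrightarrow>
           family_iso n F (nsets {1..n} k - lex_initial n k ((n choose k) - m))))"
proof -
  let ?U = "nsets {1..n} k"
  have bounds: "4 * k\<^sup>2 * (k - 1) * s < n - 1 \<and> s \<le> n" if "s \<le> r" for s
    using size_condition_sufficient[OF assms(2,3,4) that] .
  have upper: "omega F' \<le> omega (lex_initial n k (card F')) \<and>
      (omega F' = omega (lex_initial n k (card F')) \<longleftrightarrow> family_iso n F' (lex_initial n k (card F')))"
    if "F' \<subseteq> ?U" "card F' = (n choose k) - ((n - s) choose k)" "1 \<le> s" "s \<le> r" for F' s
    using omega_le_meeting[OF that(1) assms(2), of s] bounds[OF that(4)] that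
      lex_initial_eq_meeting[of s n k] by simp
  have "omega F \<le> omega (?U - lex_initial n k ((n choose k) - m)) \<and>
        (omega F = omega (?U - lex_initial n k ((n choose k) - m)) \<longleftrightarrow>
           family_iso n F (?U - lex_initial n k ((n choose k) - m)))"
    if m: "m = (n - s) choose k" and s: "1 \<le> s" "s \<le> r" for s
  proof -
    let ?C = "?U - F" and ?L = "lex_initial n k ((n choose k) - m)"
    have finF: "finite F" using finite_family assms(5) by blast
    have cC: "card ?C = (n choose k) - m"
      using assms(5,6) finF by (simp add: card_Diff_subset)
    have L: "?L \<subseteq> ?U" by (auto simp: lex_initial_def)
    have "?L = meeting {1..n} k {1..s}"
      using lex_initial_eq_meeting[of s n k] bounds[OF s(2)] m by simp
    then have cL: "card ?L = card ?C"
      using card_meeting[of "{1..n}" "{1..s}" k] bounds[OF s(2)] m cC by simp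
    have UC: "?U - ?C = F" using assms(5) by auto
    have "omega ?C \<le> omega ?L \<and> (omega ?C = omega ?L \<longleftrightarrow> family_iso n ?C ?L)"
      using upper[of ?C s] cC m s by simp
    moreover have "real (omega F) - omega ?C = real (omega (?U - ?L)) - omega ?L"
      using omega_complement_diff[OF _ L, of ?C] cL assms(2) UC by simp
    moreover have "family_iso n F (?U - ?L) \<longleftrightarrow> family_iso n ?C ?L"
      using family_iso_Diff[of ?C n k ?L] L UC by auto
    ultimately show ?thesis by auto
  qed
  then have second: "m \<in> {(n - r1) choose k | r1. 1 \<le> r1 \<and> r1 \<le> r} \<longrightarrow>
      omega F \<le> omega (?U - lex_initial n k ((n choose k) - m)) \<and>
      (omega F = omega (?U - lex_initial n k ((n choose k) - m)) \<longleftrightarrow>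
         family_iso n F (?U - lex_initial n k ((n choose k) - m)))" by blast
  have "m \<in> {(n choose k) - ((n - r1) choose k) | r1. 1 \<le> r1 \<and> r1 \<le> r} \<longrightarrow>
      omega F \<le> omega (lex_initial n k m) \<and>
      (omega F = omega (lex_initial n k m) \<longleftrightarrow> family_iso n F (lex_initial n k m))"
    using upper[OF assms(5)] unfolding assms(6) by blast
  with second show ?thesis by (rule conjI[rotated])
qed

end
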